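(* If $k\ge 3$, then there are no nonzero skew-symmetric signature tensors of order $k$. That is, for every log-signature $\ell\in\operatorname{Lie}((V))$, if $\varphi_k(\ell)\in\wedge^kV$ then $\varphi_k(\ell)=0$.
   Context: Let $\mathbb{K}\in\{\mathbb{R},\mathbb{C}\}$ and let $V$ be a finite-dimensional $\mathbb{K}$-vector space. On the tensor algebra of $V$ consider the Lie bracket $[T,S]=T\otimes S-S\otimes T$. $\operatorname{Lie}(V)$ is the smallest linear subspace of the tensor algebra that contains $V$ and is closed under brackets, and $\operatorname{Lie}^k(V)=\operatorname{Lie}(V)\cap V^{\otimes k}$. $\operatorname{Lie}((V))$ is the set of sequences $\ell=(T_{(i)}\mid i\ge 1)$ with $T_{(i)}\in\operatorname{Lie}^i(V)$ for every $i\ge1$ (the degree-zero entry being $0$); its elements are called log-signatures. For $k\ge 1$, $\varphi_k:\operatorname{Lie}((V))\to V^{\otimes k}$ is the degree-$k$ component of the exponential $\exp(T)=\sum_{n\ge0}T^{\otimes n}/n!$, i.e. $\varphi_k(\ell)=\sum\frac{1}{t!}T_{(\alpha_1)}\otimes\cdots\otimes T_{(\alpha_t)}$, the sum over all tuples of positive integers $(\alpha_1,\dots,\alpha_t)$ (of any length $t$) with $\alpha_1+\cdots+\alpha_t=k$. A signature tensor of order $k$ is a tensor of the form $\varphi_k(\ell)$ with $\ell\in\operatorname{Lie}((V))$. The space $\wedge^kV\subset V^{\otimes k}$ is the space of skew-symmetric tensors, i.e. those with $T_{i_1,\dots,i_k}=\operatorname{sgn}(\rho)T_{i_{\rho(1)},\dots,i_{\rho(k)}}$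 for every permutation $\rho$ of $\{1,\dots,k\}$. *)

theory Defs
  imports
    Complex_Main
    "HOL-Library.Function_Algebras"
    "HOL-Combinatorics.Permutations"
begin

text \<open>
  \<open>V\<close> is a vector space on the type \<open>'v\<close> over the field \<open>'k\<close>, with scalar multiplication
  \<open>scale\<close> and a finite basis \<open>B\<close>.  A tensor \<open>T\<close> is given by its coordinates: \<open>T [b\<^sub>1, \<dots>, b\<^sub>k]\<close>
  is the coefficient of \<open>b\<^sub>1 \<otimes> \<dots> \<otimes> b\<^sub>k\<close> (\<open>b\<^sub>i \<in> B\<close>), and the empty word carries the
  degree-zero entry.  The vector space structure on tensors is the pointwise one (0, +, - and
  finite sums come from \<open>Function_Algebras\<close>); the pointwise product of functions is not used.

  To quantify over \<open>\<real>\<close> and \<open>\<complex>\<close> at once, take \<open>'k\<close> of class \<open>real_normed_field\<close>: by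
  Gelfand-Mazur, \<open>real\<close> and \<open>complex\<close> are its only instances up to isomorphism.
\<close>

type_synonym ('v, 'k) tensor = "'v list \<Rightarrow> 'k"

definition tscale :: "'k::field \<Rightarrow> ('v, 'k) tensor \<Rightarrow> ('v, 'k) tensor" where
  "tscale c T = (\<lambda>w. c * T w)"

definition tone :: "('v, 'k::field) tensor" where
  "tone = (\<lambda>w. if w = [] then 1 else 0)"

definition tprod :: "('v, 'k::field) tensor \<Rightarrow> ('v, 'k) tensor \<Rightarrow> ('v, 'k) tensor"
    (infixl "\<otimes>\<^sub>t" 70) where
  "T \<otimes>\<^sub>t S = (\<lambda>w. \<Sum>i\<le>length w. T (take i w) * S (drop i w))"

definition tprod_list :: "('v, 'k::field) tensor list \<Rightarrow> ('v, 'k) tensor" where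
  "tprod_list Ts = foldr (\<otimes>\<^sub>t) Ts tone"

definition tensor_algebra :: "'v set \<Rightarrow> ('v, 'k::field) tensor set" where
  "tensor_algebra B = {T. finite {w. T w \<noteq> 0} \<and> (\<forall>w. T w \<noteq> 0 \<longrightarrow> set w \<subseteq> B)}"

definition tensor_power :: "'v set \<Rightarrow> nat \<Rightarrow> ('v, 'k::field) tensor set" where
  "tensor_power B k = {T \<in> tensor_algebra B. \<forall>w. T w \<noteq> 0 \<longrightarrow> length w = k}"

text \<open>The inclusion of \<open>V\<close> as the degree-one part of the tensor algebra.\<close>

definition tvec :: "('k::field \<Rightarrow> 'v::ab_group_add \<Rightarrow> 'v) \<Rightarrow> 'v set \<Rightarrow> 'v \<Rightarrow> ('v, 'k) tensor" where
  "tvec scale B v = (\<lambda>w. case w of [b] \<Rightarrow> module.representation scale B v b | _ \<Rightarrow> 0)"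

definition tbracket :: "('v, 'k::field) tensor \<Rightarrow> ('v, 'k) tensor \<Rightarrow> ('v, 'k) tensor" where
  "tbracket T S = T \<otimes>\<^sub>t S - S \<otimes>\<^sub>t T"

definition Lie :: "('k::field \<Rightarrow> 'v::ab_group_add \<Rightarrow> 'v) \<Rightarrow> 'v set \<Rightarrow> ('v, 'k) tensor set" where
  "Lie scale B = \<Inter> {U. U \<subseteq> tensor_algebra B \<and> module.subspace tscale U \<and>
                        range (tvec scale B) \<subseteq> U \<and> (\<forall>T\<in>U. \<forall>S\<in>U. tbracket T S \<in> U)}"

definition Lie_deg ::
  "('k::field \<Rightarrow> 'v::ab_group_add \<Rightarrow> 'v) \<Rightarrow> 'v set \<Rightarrow> nat \<Rightarrow> ('v, 'k) tensor set" where
  "Lie_deg scale B k = Lie scale B \<inter> tensor_power B k"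

definition log_signatures ::
  "('k::field \<Rightarrow> 'v::ab_group_add \<Rightarrow> 'v) \<Rightarrow> 'v set \<Rightarrow> (nat \<Rightarrow> ('v, 'k) tensor) set" where
  "log_signatures scale B = {l. l 0 = 0 \<and> (\<forall>i\<ge>1. l i \<in> Lie_deg scale B i)}"

definition compositions :: "nat \<Rightarrow> nat list set" where
  "compositions k = {\<alpha>. (\<forall>a\<in>set \<alpha>. 1 \<le> a) \<and> sum_list \<alpha> = k}"

definition sig_phi :: "nat \<Rightarrow> (nat \<Rightarrow> ('v, 'k::field_char_0) tensor) \<Rightarrow> ('v, 'k) tensor" where
  "sig_phi k l =
     (\<Sum>\<alpha>\<in>compositions k. tscale (1 / fact (length \<alpha>)) (tprod_list (map l \<alpha>)))"

text \<open>\<open>permute_list \<rho> [i\<^sub>1, \<dots>, i\<^sub>k]\<close> is \<open>[i\<^bsub>\<rho> 1\<^esub>, \<dots>, i\<^bsub>\<rho> k\<^esub>]\<close>; positions are counted from 0.\<close>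

definition skew_tensors :: "'v set \<Rightarrow> nat \<Rightarrow> ('v, 'k::field) tensor set" where
  "skew_tensors B k =
     {T \<in> tensor_power B k.
        \<forall>w. set w \<subseteq> B \<and> length w = k \<longrightarrow>
          (\<forall>\<rho>. \<rho> permutes {..<k} \<longrightarrow> T w = of_int (sign \<rho>) * T (permute_list \<rho> w))}"

text \<open>
  The following facts confirm that the encodings are not degenerate: the sum defining
  \<open>sig_phi\<close> is finite, products of basis vectors are the expected words, and the tensor
  algebra itself is one of the sets intersected in \<open>Lie\<close>.
\<close>

lemma finite_compositions: "finite (compositions k)"
proof -
  have "length \<alpha> \<le> sum_list \<alpha>" if "\<forall>a\<in>set \<alpha>. 1 \<le> a" for \<alpha> :: "nat list"
    using that by (induction \<alpha>) auto
  then have "compositions k \<subseteq> {\<alpha>. set \<alpha> \<subseteq> {..k} \<and> length \<alpha> \<le> k}"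
    by (auto simp: compositions_def intro: member_le_sum_list)
  then show ?thesis
    by (rule finite_subset) (rule finite_lists_length_le, simp)
qed

lemma tprod_list_basis:
  assumes "vector_space scale" "\<not> module.dependent scale B" "set bs \<subseteq> B"
  shows "tprod_list (map (tvec scale B) bs) = (\<lambda>w. if w = bs then 1 else 0)"
  using assms(3)
proof (induction bs)
  case Nil
  show ?case by (simp add: tprod_list_def tone_def)
next
  case (Cons b bs)
  interpret vector_space scale by fact
  have rep: "representation B b = (\<lambda>c. if c = b then 1 else 0)"
    using Cons.prems assms(2) by (intro representation_basis) auto
  have IH: "foldr (\<otimes>\<^sub>t) (map (tvec scale B) bs) tone = (\<lambda>w. if w = bs then 1 else 0)"
    using Cons by (simp add: tprod_list_def)
  show ?case
  proof
    fix w
    have vec: "tvec scale B b u = (if u = [b] then 1 else 0)" for u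
      by (simp add: tvec_def rep split: list.split)
    have "tprod_list (map (tvec scale B) (b # bs)) w =
        (\<Sum>i\<le>length w. tvec scale B b (take i w) * (if drop i w = bs then 1 else 0))"
      by (simp add: tprod_list_def tprod_def IH)
    also have "\<dots> = (\<Sum>i\<le>length w. if i = 1 then (if w = b # bs then 1 else 0) else 0)"
    proof (rule sum.cong[OF refl])
      fix i assume i: "i \<in> {..length w}"
      have "take i w = [b] \<and> drop i w = bs \<longleftrightarrow> i = 1 \<and> w = b # bs"
      proof
        assume *: "take i w = [b] \<and> drop i w = bs"
        have "length (take i w) = i" using i by simp
        with * have "i = 1" by simp
        moreover have "w = [b] @ bs" using * by (metis append_take_drop_id)
        ultimately show "i = 1 \<and> w = b # bs" by simp
      qed simp
      then show "tvec scale B b (take i w) * (if drop i w = bs then 1 else 0) =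
          (if i = 1 then (if w = b # bs then 1 else 0) else 0)"
        unfolding vec by (cases "i = 1"; cases "w = b # bs"; cases "take i w = [b]") simp_all
    qed
    also have "\<dots> = (if w = b # bs then 1 else 0)"
      by (subst sum.delta) (auto simp: Suc_le_eq)
    finally show "tprod_list (map (tvec scale B) (b # bs)) w = (if w = b # bs then 1 else 0)" .
  qed
qed

lemma module_tscale: "module (tscale :: 'k::field \<Rightarrow> ('v, 'k) tensor \<Rightarrow> _)"
  by unfold_locales (auto simp: tscale_def fun_eq_iff algebra_simps)

lemma subspace_tensor_algebra:
  "module.subspace tscale (tensor_algebra B :: ('v, 'k::field) tensor set)"
proof -
  interpret module "tscale :: 'k \<Rightarrow> ('v, 'k) tensor \<Rightarrow> _" by (rule module_tscale)
  show ?thesis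
  proof (rule subspaceI)
    show "0 \<in> (tensor_algebra B :: ('v, 'k) tensor set)"
      by (simp add: tensor_algebra_def)
  next
    fix T S :: "('v, 'k) tensor" assume TS: "T \<in> tensor_algebra B" "S \<in> tensor_algebra B"
    have "{w. (T + S) w \<noteq> 0} \<subseteq> {w. T w \<noteq> 0} \<union> {w. S w \<noteq> 0}" by auto
    with TS show "T + S \<in> tensor_algebra B"
      by (auto simp: tensor_algebra_def intro: finite_subset)
  next
    fix c :: 'k and T :: "('v, 'k) tensor" assume T: "T \<in> tensor_algebra B"
    have "{w. tscale c T w \<noteq> 0} \<subseteq> {w. T w \<noteq> 0}" by (auto simp: tscale_def)
    with T show "tscale c T \<in> tensor_algebra B"
      by (auto simp: tensor_algebra_def intro: finite_subset)
  qed
qed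

lemma tprod_tensor_algebra:
  assumes "T \<in> tensor_algebra B" "S \<in> tensor_algebra B"
  shows "T \<otimes>\<^sub>t S \<in> tensor_algebra B"
proof -
  have *: "\<exists>u v. w = u @ v \<and> T u \<noteq> 0 \<and> S v \<noteq> 0" if "(T \<otimes>\<^sub>t S) w \<noteq> 0" for w
    using that unfolding tprod_def
    by (metis (mono_tags, lifting) append_take_drop_id mult_eq_0_iff sum.not_neutral_contains_not_neutral)
  then have "{w. (T \<otimes>\<^sub>t S) w \<noteq> 0} \<subseteq> (\<lambda>(u, v). u @ v) ` ({w. T w \<noteq> 0} \<times> {w. S w \<noteq> 0})"
    by force
  then have "finite {w. (T \<otimes>\<^sub>t S) w \<noteq> 0}"
    using assms by (auto simp: tensor_algebra_def intro: finite_subset)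
  moreover have "set w \<subseteq> B" if "(T \<otimes>\<^sub>t S) w \<noteq> 0" for w
    using *[OF that] assms by (fastforce simp: tensor_algebra_def)
  ultimately show ?thesis by (simp add: tensor_algebra_def)
qed

lemma tvec_tensor_algebra:
  assumes "vector_space scale"
  shows "tvec scale B v \<in> tensor_algebra B"
proof -
  interpret vector_space scale by fact
  have *: "\<exists>b. w = [b] \<and> representation B v b \<noteq> 0" if "tvec scale B v w \<noteq> 0" for w
    using that by (simp add: tvec_def split: list.splits)
  then have "{w. tvec scale B v w \<noteq> 0} \<subseteq> (\<lambda>b. [b]) ` {b. representation B v b \<noteq> 0}"
    by blast
  then have "finite {w. tvec scale B v w \<noteq> 0}"
    by (rule finite_subset) (simp add: finite_representation)
  moreover have "set w \<subseteq> B" if "tvec scale B v w \<noteq> 0" for w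
    using *[OF that] representation_ne_zero[of B v] by auto
  ultimately show ?thesis by (simp add: tensor_algebra_def)
qed

lemma tbracket_tensor_algebra:
  assumes "T \<in> tensor_algebra B" "S \<in> tensor_algebra B"
  shows "tbracket T S \<in> tensor_algebra B"
  unfolding tbracket_def
  by (intro module.subspace_diff[OF module_tscale] subspace_tensor_algebra
      tprod_tensor_algebra assms)

lemma Lie_subset_tensor_algebra:
  assumes "vector_space scale"
  shows "Lie scale B \<subseteq> tensor_algebra B"
  unfolding Lie_def
  by (rule Inter_lower)
     (auto simp: subspace_tensor_algebra tvec_tensor_algebra[OF assms] tbracket_tensor_algebra)

end

theory Submission
  imports Defs
begin

text \<open>
  The exponential \<open>E\<close> of a log-signature satisfies the shuffle relations: \<open>E(u) E(v)\<close> is the sum of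
  \<open>E(w)\<close> over all shuffles \<open>w\<close> of the words \<open>u\<close> and \<open>v\<close>, counted with multiplicity.  The map that
  sends a tensor to its sums over shuffles is a coproduct and multiplicative (\<open>deshuffle_tprod\<close>);
  Lie elements are primitive for it (\<open>primitive_Lie\<close>), and the exponential of a primitive series
  is grouplike by the binomial theorem (\<open>deshuffle_texp\<close>).  The components of \<open>E\<close> are the
  signature tensors (\<open>sig_phi_eq_texp\<close>).

  Let \<open>T\<close> be the component of degree \<open>k \<ge> 3\<close> and suppose that it is alternating.  Take \<open>u = [i, j]\<close>
  and \<open>v\<close> of length \<open>k - 2\<close>.  A shuffle \<open>w\<close> contributes \<open>\<plusminus>T(i j v)\<close>, so the sum is \<open>T(i j v)\<close> times
  the signed number of shuffles, which is the Gaussian binomial coefficient \<open>k\<close> over \<open>2\<close> at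
  \<open>q = -1\<close>, namely the floor of \<open>k / 2\<close> (\<open>deshuffle_alternating_2\<close>).  This is not zero, hence
  \<open>T\<close> is a product \<open>A \<otimes> C\<close> with \<open>A\<close> of degree two and \<open>C\<close> of degree \<open>k - 2 \<ge> 1\<close>.  An alternating
  tensor of this shape vanishes (\<open>alternating_outer_eq_0\<close>).  Words of length two are the right
  choice: for a single letter the signed count is zero when \<open>k\<close> is even.
\<close>

section \<open>The deshuffle coproduct\<close>

text \<open>
  The sum of \<open>T w\<close> over the shuffles \<open>w\<close> of \<open>u\<close> and \<open>v\<close>, with multiplicity, which is the coefficient
  at \<open>u \<otimes> v\<close> of the coproduct of \<open>T\<close>.  The recursion sorts the shuffles by their first letter and
  strips it, so that \<open>T\<close> is replaced by its left derivative.
\<close>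

fun deshuffle :: "('v, 'k::field) tensor \<Rightarrow> 'v list \<Rightarrow> 'v list \<Rightarrow> 'k" where
  "deshuffle T [] v = T v"
| "deshuffle T (a # u) [] = T (a # u)"
| "deshuffle T (a # u) (b # v) =
     deshuffle (\<lambda>w. T (a # w)) u (b # v) + deshuffle (\<lambda>w. T (b # w)) (a # u) v"

lemma deshuffle_Nil_right [simp]: "deshuffle T u [] = T u"
  by (cases u) auto

lemma deshuffle_cong:
  assumes "\<And>w. length w = length u + length v \<Longrightarrow> T w = S w"
  shows "deshuffle T u v = deshuffle S u v"
  using assms
proof (induction T u v arbitrary: S rule: deshuffle.induct)
  case (3 T a u b v)
  show ?case
    using 3(1)[of "\<lambda>w. S (a # w)"] 3(2)[of "\<lambda>w. S (b # w)"] 3(3) by simp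
qed auto

lemma deshuffle_linear:
  "deshuffle (\<lambda>w. c * T w + d * S w) u v = c * deshuffle T u v + d * deshuffle S u v"
proof (induction T u v arbitrary: S rule: deshuffle.induct)
  case (3 T a u b v)
  show ?case
    unfolding deshuffle.simps 3(1)[of "\<lambda>w. S (a # w)"] 3(2)[of "\<lambda>w. S (b # w)"]
    by (simp add: algebra_simps)
qed simp_all

lemma deshuffle_eq_0:
  assumes "\<And>w. length w = length u + length v \<Longrightarrow> T w = 0"
  shows "deshuffle T u v = 0"
proof -
  have "deshuffle T u v = deshuffle (\<lambda>w. 0 * T w + 0 * T w) u v"
    using assms by (intro deshuffle_cong) simp
  also have "\<dots> = 0 * deshuffle T u v + 0 * deshuffle T u v" by (rule deshuffle_linear)
  finally show ?thesis by simp
qed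

lemma deshuffle_sum:
  assumes "finite A"
  shows "deshuffle (\<lambda>w. \<Sum>n\<in>A. c n * T n w) u v = (\<Sum>n\<in>A. c n * deshuffle (T n) u v)"
  using assms
proof induction
  case empty
  show ?case by (simp add: deshuffle_eq_0)
next
  case (insert n A)
  then show ?case
    using deshuffle_linear[of "c n" "T n" 1 "\<lambda>w. \<Sum>n\<in>A. c n * T n w" u v] by simp
qed

text \<open>
  Functions of two words are the coefficients of elements of the completed tensor square of the
  tensor algebra; \<open>bprod\<close> is the product there, \<open>(A \<otimes> C) \<cdot> (A' \<otimes> C') = A A' \<otimes> C C'\<close>.
\<close>

definition bprod ::
  "('v list \<Rightarrow> 'v list \<Rightarrow> 'k::field) \<Rightarrow> ('v list \<Rightarrow> 'v list \<Rightarrow> 'k) \<Rightarrow> 'v list \<Rightarrow> 'v list \<Rightarrow> 'k"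
  where "bprod F G = (\<lambda>u v. \<Sum>i\<le>length u. \<Sum>j\<le>length v.
    F (take i u) (take j v) * G (drop i u) (drop j v))"

definition outer :: "('v, 'k::field) tensor \<Rightarrow> ('v, 'k) tensor \<Rightarrow> 'v list \<Rightarrow> 'v list \<Rightarrow> 'k" where
  "outer A C = (\<lambda>u v. A u * C v)"

lemma bprod_outer: "bprod (outer A C) (outer A' C') = outer (A \<otimes>\<^sub>t A') (C \<otimes>\<^sub>t C')"
  by (simp add: fun_eq_iff bprod_def outer_def tprod_def sum_product mult_ac)

lemma bprod_add_left: "bprod (F + F') G = bprod F G + bprod F' G"
  by (simp add: fun_eq_iff bprod_def algebra_simps sum.distrib)

lemma bprod_add_right: "bprod F (G + G') = bprod F G + bprod F G'"
  by (simp add: fun_eq_iff bprod_def algebra_simps sum.distrib)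

lemma bprod_sum_right:
  "bprod F (\<lambda>u v. \<Sum>a\<in>A. c a * G a u v) u v = (\<Sum>a\<in>A. c a * bprod F (G a) u v)"
proof -
  have "bprod F (\<lambda>u v. \<Sum>a\<in>A. c a * G a u v) u v = (\<Sum>i\<le>length u. \<Sum>j\<le>length v. \<Sum>a\<in>A.
      c a * (F (take i u) (take j v) * G a (drop i u) (drop j v)))"
    by (simp add: bprod_def sum_distrib_left mult_ac)
  also have "\<dots> = (\<Sum>i\<le>length u. \<Sum>a\<in>A. \<Sum>j\<le>length v.
      c a * (F (take i u) (take j v) * G a (drop i u) (drop j v)))"
    by (intro sum.cong refl sum.swap)
  also have "\<dots> = (\<Sum>a\<in>A. \<Sum>i\<le>length u. \<Sum>j\<le>length v.
      c a * (F (take i u) (take j v) * G a (drop i u) (drop j v)))"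
    by (rule sum.swap)
  also have "\<dots> = (\<Sum>a\<in>A. c a * bprod F (G a) u v)"
    by (simp add: bprod_def sum_distrib_left)
  finally show ?thesis .
qed

text \<open>
  The first letter of \<open>a # w\<close> goes to the left factor, except for the cut at the very front, where
  only the constant term of the left factor contributes.
\<close>

lemma tprod_Cons: "(T \<otimes>\<^sub>t S) (a # w) = ((\<lambda>w. T (a # w)) \<otimes>\<^sub>t S) w + T [] * S (a # w)"
  unfolding tprod_def by (simp add: sum.atMost_Suc_shift del: sum.atMost_Suc)

text \<open>
  Cutting a shuffle of \<open>u\<close> and \<open>v\<close> at some place gives a shuffle of prefixes of \<open>u\<close> and \<open>v\<close> followed
  by a shuffle of the remaining suffixes, in a bijective way.  The formal proof follows the first
  letter instead: both sides satisfy the recursion coming from \<open>tprod_Cons\<close>.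
\<close>

lemma deshuffle_tprod: "deshuffle (T \<otimes>\<^sub>t S) = bprod (deshuffle T) (deshuffle S)"
proof (intro ext)
  fix u v
  show "deshuffle (T \<otimes>\<^sub>t S) u v = bprod (deshuffle T) (deshuffle S) u v"
  proof (induction T u v rule: deshuffle.induct)
    case (3 T a u b v)
    let ?Ta = "\<lambda>w. T (a # w)" and ?Tb = "\<lambda>w. T (b # w)"
    have shift: "(\<lambda>w. (T \<otimes>\<^sub>t S) (c # w)) =
        (\<lambda>w. 1 * ((\<lambda>w. T (c # w)) \<otimes>\<^sub>t S) w + T [] * S (c # w))" for c
      by (simp add: tprod_Cons)
    have "deshuffle (T \<otimes>\<^sub>t S) (a # u) (b # v) =
        bprod (deshuffle ?Ta) (deshuffle S) u (b # v) +
        bprod (deshuffle ?Tb) (deshuffle S) (a # u) v + T [] * deshuffle S (a # u) (b # v)"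
      unfolding deshuffle.simps(3) shift deshuffle_linear 3 by (simp add: distrib_left)
    \<comment> \<open>On the right, the term with two empty prefixes is the one with \<open>T []\<close>; in all others the
      left factor unfolds by one step of the recursion.\<close>
    also have "\<dots> = bprod (deshuffle T) (deshuffle S) (a # u) (b # v)"
      by (simp add: bprod_def sum.atMost_Suc_shift sum.distrib algebra_simps
          del: sum.atMost_Suc)
    finally show ?case .
  qed (simp_all add: bprod_def tprod_def)
qed

section \<open>Lie elements are primitive\<close>

lemma tone_tprod [simp]: "tone \<otimes>\<^sub>t T = T"
proof
  fix w
  have "(tone \<otimes>\<^sub>t T) w = (\<Sum>i\<le>length w. if i = 0 then T w else 0)"
    unfolding tprod_def tone_def by (intro sum.cong) auto
  then show "(tone \<otimes>\<^sub>t T) w = T w" by simp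
qed

lemma tprod_tone [simp]: "T \<otimes>\<^sub>t tone = T"
proof
  fix w
  have "(T \<otimes>\<^sub>t tone) w = (\<Sum>i\<le>length w. if i = length w then T w else 0)"
    unfolding tprod_def tone_def by (intro sum.cong) auto
  then show "(T \<otimes>\<^sub>t tone) w = T w" by simp
qed

definition primitive :: "('v, 'k::field) tensor \<Rightarrow> bool" where
  "primitive T \<longleftrightarrow> deshuffle T = outer T tone + outer tone T"

text \<open>
  Comparing coefficients at two empty words gives \<open>T [] = T [] + T []\<close>.
\<close>

lemma primitive_Nil:
  assumes "primitive T"
  shows "T [] = 0"
proof -
  have "deshuffle T [] [] = (outer T tone + outer tone T) [] []"
    using assms by (simp add: primitive_def)
  then have "T [] = T [] + T []" by (auto simp: outer_def tone_def)
  then show ?thesis by (metis add_cancel_right_right)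
qed

lemma primitive_tvec: "primitive (tvec scale B x)"
proof -
  let ?T = "tvec scale B x"
  have "deshuffle ?T u v = (outer ?T tone + outer tone ?T) u v" for u v
  proof (cases "u = [] \<or> v = []")
    case True
    moreover have "?T [] = 0" by (simp add: tvec_def)
    ultimately show ?thesis by (auto simp: outer_def tone_def)
  next
    case False
    then have "length u + length v \<noteq> 1" by (cases u; cases v) auto
    then have "deshuffle ?T u v = 0"
      by (intro deshuffle_eq_0) (auto simp: tvec_def split: list.split)
    then show ?thesis using False by (simp add: outer_def tone_def)
  qed
  then show ?thesis by (simp add: primitive_def fun_eq_iff)
qed

lemma primitive_linear:
  assumes "primitive T" "primitive S"
  shows "primitive (\<lambda>w. c * T w + d * S w)"
  using assms by (simp add: primitive_def fun_eq_iff deshuffle_linear outer_def algebra_simps)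

lemma deshuffle_tprod_primitive:
  assumes "primitive T" "primitive S"
  shows "deshuffle (T \<otimes>\<^sub>t S) =
    outer (T \<otimes>\<^sub>t S) tone + outer T S + (outer S T + outer tone (T \<otimes>\<^sub>t S))"
  using assms
  by (simp add: deshuffle_tprod primitive_def bprod_add_left bprod_add_right bprod_outer)

text \<open>
  The mixed terms \<open>T \<otimes> S + S \<otimes> T\<close> of the coproduct of \<open>T S\<close> are symmetric in \<open>T\<close> and \<open>S\<close>, hence cancel
  in the bracket.
\<close>

lemma primitive_tbracket:
  assumes "primitive T" "primitive S"
  shows "primitive (tbracket T S)"
proof -
  have eq: "tbracket T S = (\<lambda>w. 1 * (T \<otimes>\<^sub>t S) w + (-1) * (S \<otimes>\<^sub>t T) w)"
    by (simp add: tbracket_def fun_eq_iff)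
  show ?thesis
    unfolding primitive_def eq
    by (simp only: fun_eq_iff deshuffle_linear deshuffle_tprod_primitive[OF assms]
        deshuffle_tprod_primitive[OF assms(2,1)]) (simp add: outer_def algebra_simps)
qed

text \<open>
  Primitive elements form a linear subspace that contains \<open>V\<close> and is closed under brackets, and
  \<open>Lie\<close> is the smallest such subspace.
\<close>

lemma primitive_Lie:
  assumes "vector_space scale" "T \<in> Lie scale B"
  shows "primitive T"
proof -
  interpret tensors: module "tscale :: 'a \<Rightarrow> ('b, 'a) tensor \<Rightarrow> _" by (rule module_tscale)
  let ?U = "{T \<in> tensor_algebra B. primitive T} :: ('b, 'a) tensor set"
  have zero: "primitive (0 :: ('b, 'a) tensor)"
    using primitive_linear[OF primitive_tvec primitive_tvec, of 0 _ _ _ 0 scale B 0]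
    by (simp add: zero_fun_def)
  have "tensors.subspace ?U"
  proof (rule tensors.subspaceI)
    show "0 \<in> ?U" using zero tensors.subspace_0[OF subspace_tensor_algebra] by auto
  next
    fix T S :: "('b, 'a) tensor" assume "T \<in> ?U" "S \<in> ?U"
    then show "T + S \<in> ?U"
      using tensors.subspace_add[OF subspace_tensor_algebra, of T B S] primitive_linear[of T S 1 1]
      by (auto simp: plus_fun_def)
  next
    fix c and T :: "('b, 'a) tensor" assume "T \<in> ?U"
    then show "tscale c T \<in> ?U"
      using tensors.subspace_scale[OF subspace_tensor_algebra, of T B c] primitive_linear[of T 0 c 0] zero
      by (auto simp: tscale_def)
  qed
  then have "?U \<in> {U. U \<subseteq> tensor_algebra B \<and> tensors.subspace U \<and>
      range (tvec scale B) \<subseteq> U \<and> (\<forall>T\<in>U. \<forall>S\<in>U. tbracket T S \<in> U)}"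
    using primitive_tvec tvec_tensor_algebra[OF assms(1)] primitive_tbracket
      tbracket_tensor_algebra by blast
  then have "Lie scale B \<subseteq> ?U" unfolding Lie_def by (rule Inter_lower)
  with assms(2) show ?thesis by blast
qed

section \<open>The exponential of a primitive series is grouplike\<close>

definition tpower :: "('v, 'k::field) tensor \<Rightarrow> nat \<Rightarrow> ('v, 'k) tensor" where
  "tpower L n = ((\<otimes>\<^sub>t) L ^^ n) tone"

lemma tpower_0 [simp]: "tpower L 0 = tone"
  and tpower_Suc: "tpower L (Suc n) = L \<otimes>\<^sub>t tpower L n"
  by (simp_all add: tpower_def)

lemma tpower_eq_0:
  assumes "L [] = 0" "length w < n"
  shows "tpower L n w = 0"
  using assms(2)
proof (induction n arbitrary: w)
  case (Suc n)
  have "L (take i w) * tpower L n (drop i w) = 0" if "i \<le> length w" for i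
  proof (cases "take i w = []")
    case True
    then have "L (take i w) = 0" using assms(1) by (simp only:)
    then show ?thesis by simp
  next
    case False
    then have "0 < i" "0 < length w" by auto
    then have "length (drop i w) < n" using Suc.prems unfolding length_drop by linarith
    then show ?thesis using Suc.IH by simp
  qed
  then show ?case unfolding tpower_Suc tprod_def by (intro sum.neutral) blast
qed simp

lemma deshuffle_tone: "deshuffle tone = outer tone tone"
proof (intro ext)
  fix u v :: "'v list"
  show "deshuffle tone u v = (outer tone tone u v :: 'k::field)"
  proof (cases "u = [] \<or> v = []")
    case False
    then have "deshuffle (tone :: ('v, 'k) tensor) u v = 0"
      by (intro deshuffle_eq_0) (auto simp: tone_def)
    then show ?thesis using False by (simp add: outer_def tone_def)
  qed (auto simp: outer_def tone_def)
qed

text \<open>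
  This is the binomial theorem for the power \<open>(L \<otimes> 1 + 1 \<otimes> L)\<^sup>n\<close> of two commuting elements of the
  tensor square.
\<close>

lemma deshuffle_tpower:
  assumes "primitive L"
  shows "deshuffle (tpower L n) u v =
    (\<Sum>a\<le>n. of_nat (n choose a) * outer (tpower L a) (tpower L (n - a)) u v)"
proof (induction n arbitrary: u v)
  case 0
  show ?case by (simp add: deshuffle_tone)
next
  case (Suc n)
  define f where "f a b = outer (tpower L a) (tpower L b) u v" for a b
  have "deshuffle (tpower L n) =
      (\<lambda>u v. \<Sum>a\<le>n. of_nat (n choose a) * outer (tpower L a) (tpower L (n - a)) u v)"
    using Suc by (intro ext)
  then have "deshuffle (tpower L (Suc n)) u v =
      (\<Sum>a\<le>n. of_nat (n choose a) * (f (Suc a) (n - a) + f a (Suc (n - a))))"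
    using assms by (simp add: tpower_Suc deshuffle_tprod primitive_def bprod_sum_right
        bprod_add_left bprod_outer f_def distrib_left sum.distrib)
  also have "\<dots> = (\<Sum>a\<le>n. of_nat (n choose a) * f (Suc a) (n - a)) +
      (\<Sum>a\<le>n. of_nat (n choose a) * f a (Suc n - a))"
    by (simp add: distrib_left sum.distrib Suc_diff_le)
  \<comment> \<open>The term added for \<open>a = Suc n\<close> has coefficient zero; splitting off \<open>a = 0\<close> then aligns both
    sums for Pascal's rule.\<close>
  also have "(\<Sum>a\<le>n. of_nat (n choose a) * f a (Suc n - a)) =
      (\<Sum>a\<le>Suc n. of_nat (n choose a) * f a (Suc n - a))"
    by (simp add: binomial_eq_0)
  also have "\<dots> = f 0 (Suc n) + (\<Sum>a\<le>n. of_nat (n choose Suc a) * f (Suc a) (n - a))"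
    by (subst sum.atMost_Suc_shift) simp
  also have "(\<Sum>a\<le>n. of_nat (n choose a) * f (Suc a) (n - a)) + \<dots> =
      (\<Sum>a\<le>Suc n. of_nat (Suc n choose a) * f a (Suc n - a))"
    by (subst sum.atMost_Suc_shift) (simp add: algebra_simps sum.distrib)
  finally show ?case unfolding f_def .
qed

text \<open>
  The exponential of a series \<open>L\<close> with \<open>L [] = 0\<close>: higher powers of such an \<open>L\<close> vanish at \<open>w\<close>
  (\<open>tpower_eq_0\<close>), so that cutting the series at \<open>length w\<close> changes nothing.
\<close>

definition texp :: "('v, 'k::field_char_0) tensor \<Rightarrow> ('v, 'k) tensor" where
  "texp L = (\<lambda>w. \<Sum>n\<le>length w. 1 / fact n * tpower L n w)"

text \<open>
  \<open>exp (L \<otimes> 1 + 1 \<otimes> L) = exp L \<otimes> exp L\<close>, because the two summands commute; in coordinates this is the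
  shuffle relation.
\<close>

theorem deshuffle_texp:
  fixes L :: "('v, 'k::field_char_0) tensor"
  assumes "primitive L"
  shows "deshuffle (texp L) u v = texp L u * texp L v"
proof -
  define g where "g a b = (1 / fact a * tpower L a u) * (1 / fact b * tpower L b v)" for a b
  define N where "N = length u + length v"
  have g0: "g a b = 0" if "length u < a \<or> length v < b" for a b
    using that tpower_eq_0[of L, OF primitive_Nil[OF assms]] by (auto simp: g_def)
  have "deshuffle (texp L) u v = deshuffle (\<lambda>w. \<Sum>n\<le>N. 1 / fact n * tpower L n w) u v"
    by (intro deshuffle_cong) (simp add: texp_def N_def)
  also have "\<dots> = (\<Sum>n\<le>N. 1 / fact n * deshuffle (tpower L n) u v)"
    by (rule deshuffle_sum) simp
  also have "\<dots> = (\<Sum>n\<le>N. \<Sum>a\<le>n. g a (n - a))"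
    unfolding deshuffle_tpower[OF assms] sum_distrib_left
    by (intro sum.cong refl) (simp add: g_def outer_def binomial_fact field_simps)
  also have "\<dots> = (\<Sum>(a, b)\<in>{(a, b). a + b \<le> N}. g a b)"
    by (rule sum.triangle_reindex_eq[symmetric])
  \<comment> \<open>The triangle contains the rectangle, and \<open>g\<close> vanishes outside the rectangle.\<close>
  also have "\<dots> = (\<Sum>(a, b)\<in>{..length u} \<times> {..length v}. g a b)"
  proof (rule sum.mono_neutral_right)
    have "{(a, b). a + b \<le> N} \<subseteq> {..N} \<times> {..N}" by auto
    then show "finite {(a, b). a + b \<le> N}" by (rule finite_subset) simp
    show "{..length u} \<times> {..length v} \<subseteq> {(a, b). a + b \<le> N}"
      by (auto simp: N_def)
    show "\<forall>p\<in>{(a, b). a + b \<le> N} - {..length u} \<times> {..length v}. (case p of (a, b) \<Rightarrow> g a b) = 0"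
      using g0 by (force simp: not_le)
  qed
  also have "\<dots> = texp L u * texp L v"
    by (simp add: texp_def g_def sum_product sum.cartesian_product)
  finally show ?thesis .
qed

section \<open>Signature tensors as components of an exponential\<close>

lemma tprod_list_Cons: "tprod_list (T # Ts) = T \<otimes>\<^sub>t tprod_list Ts"
  by (simp add: tprod_list_def)

text \<open>
  A sequence of homogeneous tensors is assembled into the single series \<open>\<lambda>w. l (length w) w\<close>.  A
  factorization of \<open>w\<close> into \<open>n\<close> words contributes to the \<open>n\<close>-th power of this series through the
  components prescribed by the lengths of the factors, and these lengths form a composition.
\<close>

lemma tpower_eq_sum_compositions:
  assumes supp: "\<And>i w. l i w \<noteq> 0 \<Longrightarrow> length w = i" and "l 0 = 0"
  shows "tpower (\<lambda>w. l (length w) w) n w =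
    (\<Sum>\<alpha>\<in>{\<alpha> \<in> compositions (length w). length \<alpha> = n}. tprod_list (map l \<alpha>) w)"
proof (induction n arbitrary: w)
  case 0
  have "{\<alpha> \<in> compositions (length w). length \<alpha> = 0} = (if w = [] then {[]} else {})"
    by (auto simp: compositions_def)
  then show ?case by (simp add: tprod_list_def tone_def)
next
  case (Suc n)
  let ?C = "\<lambda>m n. {\<alpha> \<in> compositions m. length \<alpha> = n}"
  have fin: "finite (?C m n)" for m n using finite_compositions by auto
  have split: "?C (length w) (Suc n) =
      (\<lambda>(i, \<alpha>). i # \<alpha>) ` (SIGMA i:{1..length w}. ?C (length w - i) n)"
    by (auto simp: compositions_def length_Suc_conv image_iff)
  \<comment> \<open>By homogeneity, only the cut after \<open>i\<close> letters contributes when the first factor is \<open>l i\<close>.\<close>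
  have head: "tprod_list (map l (i # \<alpha>)) w = l i (take i w) * tprod_list (map l \<alpha>) (drop i w)"
    if "i \<le> length w" for i \<alpha>
  proof -
    have "tprod_list (map l (i # \<alpha>)) w =
        (\<Sum>j\<le>length w. if j = i then l i (take i w) * tprod_list (map l \<alpha>) (drop i w) else 0)"
      unfolding list.map tprod_list_Cons tprod_def
    proof (intro sum.cong refl)
      fix j assume "j \<in> {..length w}"
      then have "l i (take j w) = 0" if "j \<noteq> i" using supp[of i "take j w"] that by fastforce
      then show "l i (take j w) * tprod_list (map l \<alpha>) (drop j w) =
          (if j = i then l i (take i w) * tprod_list (map l \<alpha>) (drop i w) else 0)" by auto
    qed
    then show ?thesis using that by simp
  qed
  have "tpower (\<lambda>w. l (length w) w) (Suc n) w =
      (\<Sum>i\<le>length w. \<Sum>\<alpha>\<in>?C (length w - i) n. l i (take i w) * tprod_list (map l \<alpha>) (drop i w))"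
    unfolding tpower_Suc tprod_def Suc by (simp add: sum_distrib_left)
  also have "\<dots> = (\<Sum>i=1..length w. \<Sum>\<alpha>\<in>?C (length w - i) n.
      l i (take i w) * tprod_list (map l \<alpha>) (drop i w))"
    by (rule sum.mono_neutral_right) (auto simp: assms(2) not_le)
  also have "\<dots> = (\<Sum>i=1..length w. \<Sum>\<alpha>\<in>?C (length w - i) n. tprod_list (map l (i # \<alpha>)) w)"
    by (intro sum.cong refl) (auto simp: head simp del: list.map)
  also have "\<dots> = (\<Sum>(i, \<alpha>)\<in>(SIGMA i:{1..length w}. ?C (length w - i) n).
      tprod_list (map l (i # \<alpha>)) w)"
    by (rule sum.Sigma) (auto intro: fin)
  also have "\<dots> = (\<Sum>\<alpha>\<in>?C (length w) (Suc n). tprod_list (map l \<alpha>) w)"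
    unfolding split by (subst sum.reindex) (auto simp: inj_on_def case_prod_unfold)
  finally show ?case .
qed

lemma sum_fun_apply: "(\<Sum>a\<in>A. f a) x = (\<Sum>a\<in>A. f a x)"
  by (induction A rule: infinite_finite_induct) auto

lemma sig_phi_eq_texp:
  fixes l :: "nat \<Rightarrow> ('v, 'k::field_char_0) tensor"
  assumes "\<And>i w. l i w \<noteq> 0 \<Longrightarrow> length w = i" "l 0 = 0"
  shows "sig_phi (length w) l w = texp (\<lambda>w. l (length w) w) w"
proof -
  have le: "length \<alpha> \<le> length w" if "\<alpha> \<in> compositions (length w)" for \<alpha>
  proof -
    have "length \<alpha> \<le> sum_list \<alpha>" if "\<forall>a\<in>set \<alpha>. 1 \<le> a" for \<alpha> :: "nat list"
      using that by (induction \<alpha>) auto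
    from this[of \<alpha>] show ?thesis using that by (simp add: compositions_def)
  qed
  have "sig_phi (length w) l w =
      (\<Sum>\<alpha>\<in>compositions (length w). 1 / fact (length \<alpha>) * tprod_list (map l \<alpha>) w)"
    by (simp add: sig_phi_def sum_fun_apply tscale_def)
  also have "\<dots> = (\<Sum>n\<le>length w. \<Sum>\<alpha>\<in>{\<alpha> \<in> compositions (length w). length \<alpha> = n}.
      1 / fact (length \<alpha>) * tprod_list (map l \<alpha>) w)"
    using le by (intro sum.group[symmetric] finite_compositions) auto
  also have "\<dots> = texp (\<lambda>w. l (length w) w) w"
    unfolding texp_def
  proof (intro sum.cong refl)
    fix n
    have "tpower (\<lambda>w. l (length w) w) n w =
        (\<Sum>\<alpha>\<in>{\<alpha> \<in> compositions (length w). length \<alpha> = n}. tprod_list (map l \<alpha>) w)"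
      by (rule tpower_eq_sum_compositions[where l = l, OF assms])
    then show "(\<Sum>\<alpha>\<in>{\<alpha> \<in> compositions (length w). length \<alpha> = n}.
        1 / fact (length \<alpha>) * tprod_list (map l \<alpha>) w) =
        1 / fact n * tpower (\<lambda>w. l (length w) w) n w"
      by (simp add: sum_divide_distrib)
  qed
  finally show ?thesis .
qed

text \<open>
  The coproduct is graded: its value at \<open>(u, v)\<close> depends on words of length
  \<open>length u + length v\<close> only, and thus on a single component of the series.
\<close>

lemma primitive_series:
  assumes "\<And>i. primitive (l i)"
  shows "primitive (\<lambda>w. l (length w) w)"
proof -
  have "deshuffle (\<lambda>w. l (length w) w) u v = deshuffle (l (length u + length v)) u v" for u v
    by (rule deshuffle_cong) simp
  moreover have "deshuffle (l n) u v = outer (l n) tone u v + outer tone (l n) u v" for n u v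
    using assms[of n] by (simp add: primitive_def)
  ultimately show ?thesis
    unfolding primitive_def by (intro ext) (simp add: outer_def tone_def)
qed

section \<open>Alternating tensors\<close>

text \<open>
  Skew symmetry is recast in terms of swaps of adjacent letters, for words of all lengths and over
  all letters.  In this form it passes to left derivatives (\<open>alternating_Cons\<close>), as the recursion of
  \<open>deshuffle\<close> requires.
\<close>

definition alternating :: "('v, 'k::field) tensor \<Rightarrow> bool" where
  "alternating T \<longleftrightarrow> (\<forall>x a b y. T (x @ a # b # y) = - T (x @ b # a # y))"

lemma alternatingD: "alternating T \<Longrightarrow> T (x @ a # b # y) = - T (x @ b # a # y)"
  unfolding alternating_def by blast

lemma alternating_swap01: "alternating T \<Longrightarrow> T (a # b # y) = - T (b # a # y)"
  using alternatingD[of T "[]" a b y] by (simp only: append_Nil)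

lemma alternating_swap12: "alternating T \<Longrightarrow> T (c # a # b # y) = - T (c # b # a # y)"
  using alternatingD[of T "[c]" a b y] by (simp only: append_Nil append_Cons)

lemma alternating_Cons:
  assumes "alternating T"
  shows "alternating (\<lambda>w. T (a # w))"
  unfolding alternating_def
proof (intro allI)
  fix x b c y
  show "T (a # x @ b # c # y) = - T (a # x @ c # b # y)"
    using alternatingD[OF assms, of "a # x" b c y] by (simp only: append_Cons)
qed

text \<open>
  A skew tensor vanishes at words of another length or with letters outside the basis, and both
  conditions are invariant under swaps.
\<close>

lemma alternating_skew:
  fixes T :: "('v, 'k::field) tensor"
  assumes "T \<in> skew_tensors B k"
  shows "alternating T"
  unfolding alternating_def
proof (intro allI)
  fix x y :: "'v list" and a b
  let ?w = "x @ a # b # y" and ?w' = "x @ b # a # y"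
  show "T ?w = - T ?w'"
  proof (cases "set ?w \<subseteq> B \<and> length ?w = k")
    case True
    define \<rho> where "\<rho> = Transposition.transpose (length x) (Suc (length x))"
    have perm: "\<rho> permutes {..<k}"
      unfolding \<rho>_def using True by (intro permutes_swap_id) auto
    have "permute_list \<rho> ?w = ?w'"
    proof (rule nth_equalityI)
      fix i assume "i < length (permute_list \<rho> ?w)"
      then show "permute_list \<rho> ?w ! i = ?w' ! i"
        using perm True
        by (subst permute_list_nth)
           (auto simp: \<rho>_def transpose_def nth_append nth_Cons split: nat.splits)
    qed simp
    moreover have "sign \<rho> = -1" by (simp add: \<rho>_def sign_swap_id)
    moreover have "T ?w = of_int (sign \<rho>) * T (permute_list \<rho> ?w)"
      using assms True perm unfolding skew_tensors_def by blast
    ultimately show ?thesis by simp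
  next
    case False
    then have "\<not> (set ?w' \<subseteq> B \<and> length ?w' = k)" by auto
    with False assms have "T ?w = 0" "T ?w' = 0"
      unfolding skew_tensors_def tensor_power_def tensor_algebra_def by blast+
    then show ?thesis by simp
  qed
qed

text \<open>
  Inserting \<open>i\<close> at the \<open>p\<close>-th place of \<open>w\<close> contributes \<open>(-1)\<^sup>p T(i w)\<close>, and the signs for
  \<open>p = 0, \<dots>, length w\<close> add up to 1 or 0.
\<close>

lemma deshuffle_alternating_1:
  assumes "alternating T"
  shows "deshuffle T [i] w = (if even (length w) then T (i # w) else 0)"
  using assms
proof (induction w arbitrary: T)
  case (Cons b w)
  from Cons.IH[OF alternating_Cons[OF Cons.prems]] alternating_swap01[OF Cons.prems, of b i w]
  show ?case by simp
qed simp

text \<open>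
  Let \<open>c n\<close> and \<open>d n\<close> be the signed counts for one and for two letters shuffled into a word of
  length \<open>n\<close>.  If that word is \<open>b w\<close>, the shuffles starting with \<open>i\<close> contribute \<open>c n\<close> and those
  starting with \<open>b\<close> contribute \<open>d (n - 1)\<close>, as moving \<open>b\<close> past \<open>i\<close> and \<open>j\<close> costs no sign.  Hence
  \<open>d n\<close> counts the even numbers up to \<open>n\<close>.
\<close>

lemma deshuffle_alternating_2:
  assumes "alternating T"
  shows "deshuffle T [i, j] w = of_nat (length w div 2 + 1) * T (i # j # w)"
  using assms
proof (induction w arbitrary: T)
  case (Cons b w)
  have "T (b # i # j # w) = T (i # j # b # w)"
    using alternating_swap01[OF Cons.prems, of b i "j # w"]
      alternating_swap12[OF Cons.prems, of i b j w] by simp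
  then have "deshuffle T [i, j] (b # w) = (if odd (length w) then T (i # j # b # w) else 0) +
      of_nat (length w div 2 + 1) * T (i # j # b # w)"
    unfolding deshuffle.simps(3)[of T i "[j]" b w]
      deshuffle_alternating_1[OF alternating_Cons[OF Cons.prems]]
      Cons.IH[OF alternating_Cons[OF Cons.prems]] by simp
  then show ?case
    by (cases "even (length w)") (auto elim!: evenE oddE simp: distrib_right)
qed simp

text \<open>
  If \<open>T = A \<otimes> C\<close> is not zero at \<open>i j m w\<close>, then \<open>A i j\<close> is not zero; as \<open>T\<close> vanishes at the word
  \<open>i j i w\<close> with a repeated letter, \<open>C\<close> vanishes at \<open>i w\<close>.  Exchanging \<open>i\<close> and \<open>m\<close> in \<open>i j m w\<close> moves
  \<open>i w\<close> into the second factor, so \<open>T\<close> is zero there after all.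
\<close>

lemma alternating_outer_eq_0:
  fixes T :: "('v, 'k::field_char_0) tensor"
  assumes alt: "alternating T"
    and fact: "\<And>i j w. length w = Suc n \<Longrightarrow> T (i # j # w) = A i j * C w"
    and w: "length w = n"
  shows "T (i # j # m # w) = 0"
proof (rule ccontr)
  assume ne: "T (i # j # m # w) \<noteq> 0"
  have "T (j # i # i # w) + T (j # i # i # w) = 0"
    unfolding eq_neg_iff_add_eq_0[symmetric] by (rule alternating_swap12[OF alt])
  then have "T (j # i # i # w) = 0" by (simp flip: mult_2)
  then have "T (i # j # i # w) = 0" using alternating_swap01[OF alt, of i j "i # w"] by simp
  then have "A i j * C (i # w) = 0" using fact[of "i # w" i j] w by simp
  moreover have "A i j \<noteq> 0" using ne fact[of "m # w" i j] w by auto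
  ultimately have "T (m # j # i # w) = 0" using fact[of "i # w" m j] w by simp
  moreover have "T (i # j # m # w) = - T (m # j # i # w)"
    using alternating_swap12[OF alt, of i j m w] alternating_swap01[OF alt, of i m "j # w"]
      alternating_swap12[OF alt, of m i j w] by simp
  ultimately show False using ne by simp
qed

theorem theorem5p3:
  fixes scale :: "'k::real_normed_field \<Rightarrow> 'v::ab_group_add \<Rightarrow> 'v"
    and B :: "'v set"
    and k :: nat
    and l :: "nat \<Rightarrow> ('v, 'k) tensor"
  assumes "finite_dimensional_vector_space scale B"
    and "k \<ge> 3"
    and "l \<in> log_signatures scale B"
    and "sig_phi k l \<in> skew_tensors B k"
  shows "sig_phi k l = 0"
proof
  fix x
  define T where "T = sig_phi k l"
  define E where "E = texp (\<lambda>w. l (length w) w)"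
  have vs: "vector_space scale"
    using assms(1) by (simp add: finite_dimensional_vector_space_def)
  have l0: "l 0 = 0" and lL: "\<And>i. i \<ge> 1 \<Longrightarrow> l i \<in> Lie_deg scale B i"
    using assms(3) by (auto simp: log_signatures_def)
  have supp: "length w = i" if "l i w \<noteq> 0" for i w
    using that l0 lL[of i] by (cases "i = 0") (auto simp: Lie_deg_def tensor_power_def)
  have "primitive (l i)" for i
  proof (cases "i = 0")
    case True
    have "0 \<in> Lie scale B"
      using module.subspace_0[OF module_tscale] by (auto simp: Lie_def)
    then show ?thesis using True l0 primitive_Lie[OF vs] by auto
  next
    case False
    then show ?thesis using lL[of i] primitive_Lie[OF vs] by (auto simp: Lie_deg_def)
  qed
  then have grouplike: "deshuffle E u v = E u * E v" for u v
    unfolding E_def by (rule deshuffle_texp[OF primitive_series])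
  have TE: "T w = E w" if "length w = k" for w
    using sig_phi_eq_texp[of l w, OF supp l0] that by (simp add: T_def E_def)
  have alt: "alternating T" using assms(4) alternating_skew by (simp add: T_def)
  obtain n where k: "k = n + 3" using assms(2) by (metis add.commute le_Suc_ex)
  \<comment> \<open>The signed number of shuffles of two letters with the remaining \<open>k - 2\<close> letters.\<close>
  define c :: 'k where "c = of_nat (Suc n div 2 + 1)"
  have "c \<noteq> 0" unfolding c_def by (simp only: of_nat_eq_0_iff)
  have outer: "T (i # j # w) = E [i, j] / c * E w" if "length w = Suc n" for i j w
  proof -
    have "E [i, j] * E w = deshuffle T [i, j] w"
      unfolding grouplike[symmetric] using that k by (intro deshuffle_cong) (simp add: TE)
    also have "\<dots> = c * T (i # j # w)"
      using deshuffle_alternating_2[OF alt] that by (simp add: c_def)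
    finally show ?thesis using \<open>c \<noteq> 0\<close> by (simp add: field_simps)
  qed
  show "sig_phi k l x = 0 x"
  proof (cases "length x = k")
    case True
    then obtain i j m w where "x = i # j # m # w" "length w = n"
      unfolding k by (auto simp: length_Suc_conv numeral_3_eq_3)
    then show ?thesis
      using alternating_outer_eq_0[OF alt, of n "\<lambda>i j. E [i, j] / c" E, OF outer]
      by (simp add: T_def)
  next
    case False
    then show ?thesis using assms(4) by (auto simp: skew_tensors_def tensor_power_def)
  qed
qed

end
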